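(* Let $k,r\geq 2$ be fixed integers. Then $f_r(n,C_{2k})=\Omega\left(n^{\frac{r}{r-1}\cdot\frac{k-1}{k}}\right)$. Equivalently, if $K_n$ is properly edge-coloured with $o\left(n^{\frac{r}{r-1}\cdot\frac{k-1}{k}}\right)$ colours (as $n\to\infty$), then for all sufficiently large $n$ it contains $r$ pairwise vertex-disjoint, pairwise colour-isomorphic copies of $C_{2k}$.
   Context: Two subgraphs of an edge-coloured graph are colour-isomorphic if there is a graph isomorphism between them that preserves edge colours. For an integer $r\geq 2$ and a graph $H$, $f_r(n,H)$ is the smallest number $c$ such that there is a proper edge-colouring of the complete graph $K_n$ with $c$ colours containing no $r$ pairwise vertex-disjoint, pairwise colour-isomorphic copies of $H$. An edge-colouring is proper if edges sharing a vertex get different colours. *)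

theory Defs
  imports Complex_Main
begin

text \<open>Graphs are pairs (vertex set, edge set), edges being 2-element sets.
  The complete graph K_n has vertex set {..<n}.\<close>

type_synonym 'a graph = "'a set \<times> 'a set set"

definition Kn_edges :: "nat \<Rightarrow> nat set set" where
  "Kn_edges n = {{a, b} | a b. a < n \<and> b < n \<and> a \<noteq> b}"

definition proper_colouring :: "nat \<Rightarrow> (nat set \<Rightarrow> nat) \<Rightarrow> bool" where
  "proper_colouring n col \<longleftrightarrow>
     (\<forall>a b d. a < n \<and> b < n \<and> d < n \<and> a \<noteq> b \<and> a \<noteq> d \<and> b \<noteq> d
        \<longrightarrow> col {a, b} \<noteq> col {a, d})"

definition num_colours :: "nat \<Rightarrow> (nat set \<Rightarrow> nat) \<Rightarrow> nat" where
  "num_colours n col = card (col ` Kn_edges n)"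

definition subgraph_Kn :: "nat \<Rightarrow> nat graph \<Rightarrow> bool" where
  "subgraph_Kn n S \<longleftrightarrow> fst S \<subseteq> {..<n} \<and>
     snd S \<subseteq> {{a, b} | a b. a \<in> fst S \<and> b \<in> fst S \<and> a \<noteq> b}"

definition graph_iso :: "'a graph \<Rightarrow> 'b graph \<Rightarrow> ('a \<Rightarrow> 'b) \<Rightarrow> bool" where
  "graph_iso G H g \<longleftrightarrow> bij_betw g (fst G) (fst H) \<and>
     (\<forall>a\<in>fst G. \<forall>b\<in>fst G. {a, b} \<in> snd G \<longleftrightarrow> {g a, g b} \<in> snd H)"

definition is_copy :: "nat \<Rightarrow> 'a graph \<Rightarrow> nat graph \<Rightarrow> bool" where
  "is_copy n H S \<longleftrightarrow> subgraph_Kn n S \<and> (\<exists>g. graph_iso H S g)"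

definition colour_iso :: "(nat set \<Rightarrow> nat) \<Rightarrow> nat graph \<Rightarrow> nat graph \<Rightarrow> bool" where
  "colour_iso col S T \<longleftrightarrow>
     (\<exists>g. graph_iso S T g \<and> (\<forall>a\<in>fst S. \<forall>b\<in>fst S. {a, b} \<in> snd S \<longrightarrow> col {g a, g b} = col {a, b}))"

definition has_r_copies :: "nat \<Rightarrow> nat \<Rightarrow> 'a graph \<Rightarrow> (nat set \<Rightarrow> nat) \<Rightarrow> bool" where
  "has_r_copies r n H col \<longleftrightarrow>
     (\<exists>S :: nat \<Rightarrow> nat graph.
        (\<forall>i<r. is_copy n H (S i)) \<and>
        (\<forall>i<r. \<forall>j<r. i \<noteq> j \<longrightarrow> fst (S i) \<inter> fst (S j) = {}) \<and>
        (\<forall>i<r. \<forall>j<r. i \<noteq> j \<longrightarrow> colour_iso col (S i) (S j)))"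

definition f_r :: "nat \<Rightarrow> nat \<Rightarrow> 'a graph \<Rightarrow> nat" where
  "f_r r n H = (LEAST c. \<exists>col. proper_colouring n col \<and> num_colours n col = c \<and>
                            \<not> has_r_copies r n H col)"

definition cycle_graph :: "nat \<Rightarrow> nat graph" where
  "cycle_graph m = ({..<m}, {{i, (i + 1) mod m} | i. i < m})"

end

(* Let the vertices of a graph G be the r-tuples of distinct vertices of K_n, two tuples being adjacent
   when they are joined coordinatewise by r disjoint edges of one colour. A closed 2k-walk in G whose
   tuples are pairwise disjoint is the same as r disjoint colour-isomorphic cycles. A
   neighbour of a tuple is determined by any one of its coordinates, so every tuple has at most r^2
   neighbours that meet a given tuple.

   Few colours make G dense, hence G has an induced subgraph of large minimum degree d. Let
   B = D^(-1/2) A D^(-1/2) be its normalized adjacency matrix and t_j the trace of B^(2j), i.e. the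
   weighted number of closed 2j-walks. A Cauchy-Schwarz estimate in the spirit of Janzer shows that
   closed 2k-walks with two prescribed positions meeting have weight at most
   sqrt ((r^2 / d) t_k t_{k-1}). If every closed 2k-walk had such a pair, then t_k <= eps t_{k-1} with
   eps = O(1/d), so t_k <= eps^k t_0 = eps^k |G| < 1 by log-convexity of t; but B has eigenvalue 1, so
   t_k >= 1. The normalization makes a bound on the maximum degree unnecessary. *)

theory Submission
  imports Defs "HOL-Analysis.Convex"
begin

section \<open>Powers of symmetric kernels and weighted closed walks\<close>

lemma Cauchy_Schwarz_ineq_sum2:
  fixes f g :: "'a \<Rightarrow> 'b \<Rightarrow> real"
  shows "(\<Sum>x\<in>A. \<Sum>y\<in>B. f x y * g x y)\<^sup>2
    \<le> (\<Sum>x\<in>A. \<Sum>y\<in>B. (f x y)\<^sup>2) * (\<Sum>x\<in>A. \<Sum>y\<in>B. (g x y)\<^sup>2)"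
  using Cauchy_Schwarz_ineq_sum[of "\<lambda>p. f (fst p) (snd p)" "\<lambda>p. g (fst p) (snd p)" "A \<times> B"]
  by (simp add: sum.cartesian_product case_prod_unfold)

text \<open>Nonnegativity is demanded for all arguments, so that powers and walk weights are
  nonnegative without membership conditions.\<close>

locale symmetric_kernel =
  fixes V :: "'a set" and b :: "'a \<Rightarrow> 'a \<Rightarrow> real"
  assumes finite_V [simp, intro]: "finite V"
    and kernel_commute: "x \<in> V \<Longrightarrow> y \<in> V \<Longrightarrow> b x y = b y x"
    and kernel_nonneg: "0 \<le> b x y"
begin

primrec kpow :: "nat \<Rightarrow> 'a \<Rightarrow> 'a \<Rightarrow> real" where
  "kpow 0 x y = of_bool (x = y)"
| "kpow (Suc m) x y = (\<Sum>z\<in>V. b x z * kpow m z y)"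

definition kernel_trace :: "nat \<Rightarrow> real" where
  "kernel_trace m = (\<Sum>x\<in>V. kpow m x x)"

lemma kpow_nonneg: "0 \<le> kpow m x y"
  by (induction m arbitrary: x) (auto intro!: sum_nonneg mult_nonneg_nonneg kernel_nonneg)

lemma kpow_one: "y \<in> V \<Longrightarrow> kpow (Suc 0) x y = b x y"
  by (simp add: of_bool_def if_distrib cong: if_cong)

lemma kpow_add: "x \<in> V \<Longrightarrow> kpow (m + n) x y = (\<Sum>z\<in>V. kpow m x z * kpow n z y)"
proof (induction m arbitrary: x)
  case 0
  then show ?case
    by (simp add: of_bool_def if_distrib[of "\<lambda>c. c * _"] cong: if_cong)
next
  case (Suc m)
  have "kpow (Suc m + n) x y = (\<Sum>w\<in>V. \<Sum>z\<in>V. b x w * (kpow m w z * kpow n z y))"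
    using Suc.IH by (simp add: sum_distrib_left)
  also have "\<dots> = (\<Sum>z\<in>V. kpow (Suc m) x z * kpow n z y)"
    by (subst sum.swap) (simp add: sum_distrib_right mult.assoc)
  finally show ?case .
qed

lemma kpow_commute: "x \<in> V \<Longrightarrow> y \<in> V \<Longrightarrow> kpow m x y = kpow m y x"
proof (induction m arbitrary: x y)
  case 0
  then show ?case by auto
next
  case (Suc m)
  have "kpow (Suc m) x y = (\<Sum>z\<in>V. kpow m y z * kpow (Suc 0) z x)"
    unfolding kpow.simps(2)[of m] using Suc
    by (intro sum.cong refl) (simp add: kpow_one kernel_commute mult.commute del: kpow.simps)
  also have "\<dots> = kpow (m + Suc 0) y x"
    using Suc.prems by (subst kpow_add) auto
  finally show ?case by simp
qed

text \<open>By symmetry the trace is the entrywise inner product of two powers, which opens the way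
  to Cauchy-Schwarz.\<close>

lemma kernel_trace_add:
  "kernel_trace (m + n) = (\<Sum>x\<in>V. \<Sum>y\<in>V. kpow m x y * kpow n x y)"
  unfolding kernel_trace_def
  by (intro sum.cong refl) (auto simp: kpow_add intro!: sum.cong dest: kpow_commute)

lemma kernel_trace_double: "kernel_trace (2 * m) = (\<Sum>x\<in>V. \<Sum>y\<in>V. (kpow m x y)\<^sup>2)"
  using kernel_trace_add[of m m] by (simp add: mult_2 power2_eq_square)

lemma kernel_trace_0: "kernel_trace 0 = card V"
  by (simp add: kernel_trace_def)

text \<open>The trace of order 2m + 2 is the inner product of the powers m and m + 2, whose squared
  norms are the two outer traces.\<close>

lemma kernel_trace_log_convex:
  "(kernel_trace (2 * Suc m))\<^sup>2 \<le> kernel_trace (2 * m) * kernel_trace (2 * Suc (Suc m))"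
proof -
  have "kernel_trace (2 * Suc m) = (\<Sum>x\<in>V. \<Sum>y\<in>V. kpow m x y * kpow (Suc (Suc m)) x y)"
    using kernel_trace_add[of m "Suc (Suc m)"] by (simp add: mult_2 del: kpow.simps)
  then show ?thesis
    unfolding kernel_trace_double using Cauchy_Schwarz_ineq_sum2 by (simp del: kpow.simps)
qed

text \<open>The ratios of consecutive even traces increase, so a small last ratio forces all of them to
  be small.\<close>

lemma kernel_trace_le_power:
  assumes pos: "\<And>m. 0 < kernel_trace (2 * m)"
    and last: "kernel_trace (2 * Suc m) \<le> e * kernel_trace (2 * m)"
  shows "kernel_trace (2 * Suc m) \<le> e ^ Suc m * card V"
  using last
proof (induction m)
  case 0
  then show ?case by (simp add: kernel_trace_0)
next
  case (Suc m)
  let ?t = "\<lambda>i. kernel_trace (2 * i)"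
  have e: "0 \<le> e"
    using Suc.prems pos[of "Suc m"] pos[of "Suc (Suc m)"]
    by (smt (verit) mult_nonpos_nonneg)
  \<comment> \<open>Log-convexity passes the ratio bound down by one index, where the induction
    hypothesis applies.\<close>
  have "(?t (Suc m))\<^sup>2 \<le> ?t m * ?t (Suc (Suc m))"
    by (rule kernel_trace_log_convex)
  also have "\<dots> \<le> ?t m * (e * ?t (Suc m))"
    using Suc.prems pos[of m] by (intro mult_left_mono) auto
  finally have "?t (Suc m) * ?t (Suc m) \<le> (e * ?t m) * ?t (Suc m)"
    by (simp add: power2_eq_square mult_ac)
  then have "?t (Suc m) \<le> e * ?t m"
    using pos[of "Suc m"] by (simp only: mult_le_cancel_right_pos)
  then have "?t (Suc m) \<le> e ^ Suc m * card V"
    by (rule Suc.IH)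
  then have "e * ?t (Suc m) \<le> e * (e ^ Suc m * card V)"
    using e by (rule mult_left_mono)
  with Suc.prems show ?case by (simp add: mult.assoc)
qed

section \<open>Weights of open and closed walks\<close>

fun walk_weight :: "'a list \<Rightarrow> real" where
  "walk_weight (x # y # xs) = b x y * walk_weight (y # xs)"
| "walk_weight _ = 1"

text \<open>Appending \<open>hd xs\<close> adds the step back to the start. The empty list gets
  weight 1, whatever \<open>hd []\<close> is.\<close>

definition closed_weight :: "'a list \<Rightarrow> real" where
  "closed_weight xs = walk_weight (xs @ [hd xs])"

abbreviation walks :: "nat \<Rightarrow> 'a list set" where
  "walks m \<equiv> {xs. set xs \<subseteq> V \<and> length xs = m}"

lemma walk_weight_nonneg: "0 \<le> walk_weight xs"
  by (induction xs rule: walk_weight.induct) (auto intro: kernel_nonneg mult_nonneg_nonneg)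

text \<open>The vertex \<open>y\<close> is kept in both factors, so the steps into and out of it are
  each counted once.\<close>

lemma walk_weight_append:
  "walk_weight (xs @ y # ys) = walk_weight (xs @ [y]) * walk_weight (y # ys)"
  by (induction xs rule: walk_weight.induct) auto

lemma walk_weight_pos_nth:
  "walk_weight xs \<noteq> 0 \<Longrightarrow> Suc i < length xs \<Longrightarrow> b (xs ! i) (xs ! Suc i) \<noteq> 0"
proof (induction xs arbitrary: i rule: walk_weight.induct)
  case (1 x y xs)
  then show ?case by (cases i) auto
qed auto

lemma closed_weight_pos_nth:
  assumes "closed_weight xs \<noteq> 0" "i < length xs"
  shows "b (xs ! i) (xs ! (Suc i mod length xs)) \<noteq> 0"
proof -
  have "b ((xs @ [hd xs]) ! i) ((xs @ [hd xs]) ! Suc i) \<noteq> 0"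
    using assms by (intro walk_weight_pos_nth) (auto simp: closed_weight_def)
  then show ?thesis
    using assms(2) by (cases "Suc i = length xs") (auto simp: nth_append hd_conv_nth[of xs] simp flip: length_greater_0_conv)
qed

text \<open>Cut at the first vertices of \<open>xs\<close> and \<open>ys\<close>, both closed walks
  fall into the same two open walks.\<close>

lemma closed_weight_append:
  "closed_weight (xs @ ys) = closed_weight (ys @ xs)"
proof (cases "xs = [] \<or> ys = []")
  case False
  then obtain x xs' y ys' where [simp]: "xs = x # xs'" "ys = y # ys'"
    by (meson neq_Nil_conv)
  show ?thesis
    using walk_weight_append[of "x # xs'" y "ys' @ [x]"] walk_weight_append[of "y # ys'" x "xs' @ [y]"]
    by (simp add: closed_weight_def mult.commute)
qed auto

lemma closed_weight_rotate: "closed_weight (rotate i xs) = closed_weight xs"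
  unfolding rotate_drop_take by (subst closed_weight_append) simp

lemma sum_walks_Suc: "(\<Sum>xs\<in>walks (Suc m). f xs) = (\<Sum>x\<in>V. \<Sum>xs\<in>walks m. f (x # xs))"
proof -
  have eq: "walks (Suc m) = (\<lambda>(x, xs). x # xs) ` (V \<times> walks m)"
    by (auto simp: length_Suc_conv)
  show ?thesis
    unfolding eq sum.cartesian_product
    by (subst sum.reindex) (auto simp: inj_on_def case_prod_unfold)
qed

lemma sum_walks_add:
  "(\<Sum>xs\<in>walks (m + n). f xs) = (\<Sum>ys\<in>walks m. \<Sum>zs\<in>walks n. f (ys @ zs))"
proof (induction m arbitrary: f)
  case 0
  have "walks 0 = {[]}" by auto
  then show ?case by simp
next
  case (Suc m)
  have "(\<Sum>xs\<in>walks (Suc m + n). f xs) = (\<Sum>x\<in>V. \<Sum>xs\<in>walks (m + n). f (x # xs))"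
    using sum_walks_Suc[of f "m + n"] by simp
  also have "\<dots> = (\<Sum>ys\<in>walks (Suc m). \<Sum>zs\<in>walks n. f (ys @ zs))"
    by (subst sum_walks_Suc) (simp add: Suc.IH)
  finally show ?case .
qed

text \<open>With \<open>m\<close> inner vertices the walk takes \<open>m + 1\<close> steps, hence
  the \<open>Suc\<close>.\<close>

lemma sum_walk_weight:
  "y \<in> V \<Longrightarrow> (\<Sum>xs\<in>walks m. walk_weight (x # xs @ [y])) = kpow (Suc m) x y"
proof (induction m arbitrary: x)
  case 0
  have "walks 0 = {[]}" by auto
  with 0 show ?case by (simp add: kpow_one del: kpow.simps)
next
  case (Suc m)
  then show ?case
    by (subst sum_walks_Suc) (simp add: sum_distrib_left[symmetric])
qed

text \<open>The positions 0 and \<open>j\<close> cut the closed walk into arcs of \<open>j\<close>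
  and \<open>m - j\<close> steps; for fixed ends, the inner vertices of the arcs are summed
  independently.\<close>

lemma sum_closed_weight_pair:
  fixes c :: "'a \<Rightarrow> 'a \<Rightarrow> real"
  assumes "0 < j" "j < m"
  shows "(\<Sum>xs\<in>walks m. c (xs ! 0) (xs ! j) * closed_weight xs)
    = (\<Sum>x\<in>V. \<Sum>y\<in>V. c x y * kpow j x y * kpow (m - j) x y)"
proof -
  \<comment> \<open>\<open>p\<close> and \<open>q\<close> count the inner vertices of the two arcs,
    one less than their numbers of steps.\<close>
  obtain p q where pq: "j = Suc p" "m = Suc (p + Suc q)"
    using assms by (metis add_Suc_right gr0_conv_Suc less_imp_Suc_add add_Suc)
  have *: "closed_weight (x # ys @ y # zs) = walk_weight (x # ys @ [y]) * walk_weight (y # zs @ [x])"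
    for x y ys zs
    using walk_weight_append[of "x # ys" y "zs @ [x]"] by (simp add: closed_weight_def)
  have "(\<Sum>xs\<in>walks m. c (xs ! 0) (xs ! j) * closed_weight xs)
      = (\<Sum>x\<in>V. \<Sum>ys\<in>walks p. \<Sum>y\<in>V. \<Sum>zs\<in>walks q.
          c x y * (walk_weight (x # ys @ [y]) * walk_weight (y # zs @ [x])))"
    unfolding pq sum_walks_Suc sum_walks_add by (simp add: * nth_append)
  also have "\<dots> = (\<Sum>x\<in>V. \<Sum>y\<in>V. c x y *
      ((\<Sum>ys\<in>walks p. walk_weight (x # ys @ [y])) * (\<Sum>zs\<in>walks q. walk_weight (y # zs @ [x]))))"
    unfolding sum_product unfolding sum_distrib_left by (intro sum.cong refl sum.swap)
  also have "\<dots> = (\<Sum>x\<in>V. \<Sum>y\<in>V. c x y * kpow j x y * kpow (m - j) x y)"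
    using pq by (intro sum.cong refl)
      (auto simp: sum_walk_weight mult.assoc kpow_commute simp del: kpow.simps)
  finally show ?thesis .
qed

text \<open>Rotation by \<open>i\<close> permutes the closed walks, keeps their weight and moves the
  positions \<open>i\<close>, \<open>j\<close> to 0, \<open>j - i\<close>.\<close>

lemma sum_closed_weight_rotate:
  fixes c :: "'a \<Rightarrow> 'a \<Rightarrow> real"
  assumes "i < j" "j < m"
  shows "(\<Sum>xs\<in>walks m. c (xs ! i) (xs ! j) * closed_weight xs)
    = (\<Sum>x\<in>V. \<Sum>y\<in>V. c x y * kpow (j - i) x y * kpow (m - (j - i)) x y)"
proof -
  have "(\<Sum>xs\<in>walks m. c (xs ! i) (xs ! j) * closed_weight xs)
      = (\<Sum>xs\<in>walks m. c (xs ! 0) (xs ! (j - i)) * closed_weight xs)"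
  proof (rule sum.reindex_bij_witness[where j = "rotate i" and i = "rotate (m - i)"])
    fix xs assume xs: "xs \<in> walks m"
    show "rotate (m - i) (rotate i xs) = xs" "rotate i (rotate (m - i) xs) = xs"
      using xs assms by (auto simp: rotate_rotate)
    show "rotate i xs \<in> walks m" "rotate (m - i) xs \<in> walks m"
      using xs by auto
    show "c (rotate i xs ! 0) (rotate i xs ! (j - i)) * closed_weight (rotate i xs)
        = c (xs ! i) (xs ! j) * closed_weight xs"
      using xs assms by (auto simp: nth_rotate closed_weight_rotate)
  qed
  also have "\<dots> = (\<Sum>x\<in>V. \<Sum>y\<in>V. c x y * kpow (j - i) x y * kpow (m - (j - i)) x y)"
    using assms by (intro sum_closed_weight_pair) auto
  finally show ?thesis .
qed

lemma kernel_trace_eq_sum_closed_weight: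
  assumes "0 < m"
  shows "kernel_trace m = (\<Sum>xs\<in>walks m. closed_weight xs)"
proof -
  obtain p where p: "m = Suc p" using assms gr0_conv_Suc by blast
  show ?thesis
    unfolding p sum_walks_Suc kernel_trace_def
    by (intro sum.cong refl) (simp add: closed_weight_def sum_walk_weight del: kpow.simps)
qed

end

section \<open>Closed walks avoiding a sparse relation\<close>

locale min_degree_graph =
  fixes V :: "'a set" and adj :: "'a \<Rightarrow> 'a \<Rightarrow> bool" and \<delta> :: real
  assumes finite_verts: "finite V"
    and nonempty: "V \<noteq> {}"
    and adj_commute: "adj x y \<longleftrightarrow> adj y x"
    and min_degree_pos: "0 < \<delta>"
    and min_degree: "x \<in> V \<Longrightarrow> \<delta> \<le> card {y \<in> V. adj x y}"
begin

definition deg :: "'a \<Rightarrow> real" where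
  "deg x = card {y \<in> V. adj x y}"

text \<open>The matrix D^(-1/2) A D^(-1/2): unlike the random walk matrix D^(-1) A it is symmetric,
  and it still has eigenvalue 1.\<close>

definition normalized_adj :: "'a \<Rightarrow> 'a \<Rightarrow> real" where
  "normalized_adj x y = of_bool (adj x y) / (sqrt (deg x) * sqrt (deg y))"

lemma deg_pos: "x \<in> V \<Longrightarrow> 0 < deg x"
  using min_degree[of x] min_degree_pos by (simp add: deg_def)

lemma sum_adj: "(\<Sum>y\<in>V. of_bool (adj x y)) = deg x"
  using finite_verts by (simp add: deg_def of_bool_def Int_def flip: sum.inter_filter)

sublocale symmetric_kernel V normalized_adj
proof
  show "finite V" by (rule finite_verts)
  show "normalized_adj x y = normalized_adj y x" for x y
    by (simp add: normalized_adj_def adj_commute mult.commute)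
  show "0 \<le> normalized_adj x y" for x y
    by (simp add: normalized_adj_def deg_def)
qed

text \<open>One application of the matrix to \<open>sqrt (deg y)\<close> cancels the factor at
  \<open>y\<close>; the \<open>deg x\<close> neighbours that remain each contribute
  \<open>1 / sqrt (deg x)\<close>.\<close>

lemma kpow_eigenvector: "x \<in> V \<Longrightarrow> (\<Sum>y\<in>V. kpow m x y * sqrt (deg y)) = sqrt (deg x)"
proof (induction m arbitrary: x)
  case 0
  then show ?case
    by (simp add: of_bool_def if_distrib[of "\<lambda>c. c * _"] cong: if_cong)
next
  case (Suc m)
  have "(\<Sum>y\<in>V. kpow (Suc m) x y * sqrt (deg y))
      = (\<Sum>z\<in>V. normalized_adj x z * (\<Sum>y\<in>V. kpow m z y * sqrt (deg y)))"
    by (simp add: sum_distrib_left sum_distrib_right mult.assoc) (rule sum.swap)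
  also have "\<dots> = (\<Sum>z\<in>V. of_bool (adj x z) / sqrt (deg x))"
  proof (intro sum.cong refl)
    fix z assume "z \<in> V"
    then show "normalized_adj x z * (\<Sum>y\<in>V. kpow m z y * sqrt (deg y)) = of_bool (adj x z) / sqrt (deg x)"
      using deg_pos[of z] by (simp add: Suc.IH normalized_adj_def)
  qed
  also have "\<dots> = deg x / sqrt (deg x)"
    by (simp only: sum_divide_distrib[symmetric] sum_adj)
  also have "\<dots> = sqrt (deg x)"
    using deg_pos[OF Suc.prems] by (simp add: real_div_sqrt)
  finally show ?case .
qed

text \<open>Cauchy-Schwarz stands in for the spectral theorem: the power \<open>m\<close> is paired
  with the rank-one matrix of entries \<open>sqrt (deg x) * sqrt (deg y)\<close>. The pairing equals
  \<open>S\<close> by the eigenvector identity, and the squared norm of that matrix is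
  \<open>S * S\<close>.\<close>

lemma kernel_trace_ge_1: "1 \<le> kernel_trace (2 * m)"
proof -
  define S where "S = (\<Sum>x\<in>V. deg x)"
  have S: "0 < S"
    unfolding S_def using deg_pos nonempty by (intro sum_pos) auto
  have "S = (\<Sum>x\<in>V. sqrt (deg x) * (\<Sum>y\<in>V. kpow m x y * sqrt (deg y)))"
    unfolding S_def using deg_pos
    by (intro sum.cong refl) (simp add: kpow_eigenvector less_imp_le)
  also have "\<dots> = (\<Sum>x\<in>V. \<Sum>y\<in>V. kpow m x y * (sqrt (deg x) * sqrt (deg y)))"
    by (simp add: sum_distrib_left mult_ac)
  finally have "S\<^sup>2 \<le> kernel_trace (2 * m) * (\<Sum>x\<in>V. \<Sum>y\<in>V. (sqrt (deg x) * sqrt (deg y))\<^sup>2)"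
    unfolding kernel_trace_double by (simp only: Cauchy_Schwarz_ineq_sum2)
  also have "(\<Sum>x\<in>V. \<Sum>y\<in>V. (sqrt (deg x) * sqrt (deg y))\<^sup>2) = S * S"
    unfolding S_def sum_product using deg_pos
    by (intro sum.cong refl) (simp add: power_mult_distrib less_imp_le)
  finally show ?thesis
    using S by (simp add: power2_eq_square)
qed

end

text \<open>In the application the vertices are tuples, \<open>R\<close> says that two tuples share
  an entry, and \<open>s\<close> is the square of the tuple length.\<close>

locale sparse_relation_graph = min_degree_graph +
  fixes R :: "'a \<Rightarrow> 'a \<Rightarrow> bool" and s :: real
  assumes relation_commute: "R x y \<longleftrightarrow> R y x"
    and sparse: "x \<in> V \<Longrightarrow> y \<in> V \<Longrightarrow> card {z \<in> V. adj y z \<and> R x z} \<le> s"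
begin

text \<open>A closed walk through related vertices x, v is cut at x, at the successor w of x, at v and
  at a vertex z beyond v; then Cauchy-Schwarz is applied to the sum over x, w, z.\<close>

lemma related_pair_bound:
  "(\<Sum>x\<in>V. \<Sum>v\<in>V. of_bool (R x v) * kpow (Suc p) x v * kpow (q + m) x v)\<^sup>2
    \<le> s / \<delta> * kernel_trace (2 * (p + q)) * kernel_trace (2 * m)"
proof -
  \<comment> \<open>\<open>Q\<close> is the weight of the middle stretch from \<open>w\<close> to
    \<open>z\<close> through some \<open>v\<close> related to \<open>x\<close>; \<open>P\<close>
    forgets the relation and becomes a plain power.\<close>
  define Q where "Q x w z = (\<Sum>v\<in>V. of_bool (R x v) * (kpow p w v * kpow q v z))" for x w z
  define P where "P w z = (\<Sum>v\<in>V. kpow p w v * kpow q v z)" for w z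
  have P_eq: "P w z = kpow (p + q) w z" if "w \<in> V" for w z
    using that by (simp add: P_def kpow_add)
  have Q_nonneg: "0 \<le> Q x w z" for x w z
    unfolding Q_def by (intro sum_nonneg mult_nonneg_nonneg kpow_nonneg) auto
  have P_nonneg: "0 \<le> P w z" for w z
    unfolding P_def by (intro sum_nonneg mult_nonneg_nonneg kpow_nonneg)
  have Q_le_P: "Q x w z \<le> P x' z'" if "x' = w" "z' = z" for x w z x' z'
    unfolding Q_def P_def that
    by (intro sum_mono) (auto simp: of_bool_def intro!: mult_nonneg_nonneg kpow_nonneg)
  \<comment> \<open>The weight of the step from \<open>x\<close> to \<open>w\<close> is shared out:
    \<open>f\<close> takes the root of \<open>deg w\<close>, \<open>g\<close> that of
    \<open>deg x\<close>. The idempotent indicator goes to both.\<close>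
  define f where "f xw z = (case xw of (x, w) \<Rightarrow> of_bool (adj x w) / sqrt (deg w) * Q x w z)" for xw z
  define g where "g xw z = (case xw of (x, w) \<Rightarrow> of_bool (adj x w) / sqrt (deg x) * kpow m x z)" for xw z
  \<comment> \<open>Sparseness enters here: for fixed \<open>w\<close> and \<open>v\<close>, at most
    \<open>s\<close> neighbours \<open>x\<close> of \<open>w\<close> are related to
    \<open>v\<close>.\<close>
  have sum_Q: "(\<Sum>x\<in>V. of_bool (adj x w) * Q x w z) \<le> s * P w z" if w: "w \<in> V" for w z
  proof -
    have "(\<Sum>x\<in>V. of_bool (adj x w) * Q x w z)
        = (\<Sum>v\<in>V. (\<Sum>x\<in>V. of_bool (adj w x \<and> R v x)) * (kpow p w v * kpow q v z))"
      unfolding Q_def sum_distrib_left sum_distrib_right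
      by (subst sum.swap, intro sum.cong refl)
        (simp only: of_bool_conj adj_commute[of w] relation_commute mult_ac)
    also have "\<dots> \<le> (\<Sum>v\<in>V. s * (kpow p w v * kpow q v z))"
    proof (intro sum_mono mult_right_mono mult_nonneg_nonneg kpow_nonneg)
      fix v assume "v \<in> V"
      have "(\<Sum>x\<in>V. of_bool (adj w x \<and> R v x)) = real (card {x \<in> V. adj w x \<and> R v x})"
        by (simp add: of_bool_def Int_def flip: sum.inter_filter)
      also have "\<dots> \<le> s"
        using \<open>v \<in> V\<close> w by (rule sparse)
      finally show "(\<Sum>x\<in>V. of_bool (adj w x \<and> R v x)) \<le> s" .
    qed
    finally show ?thesis by (simp add: P_def sum_distrib_left)
  qed
  have "(\<Sum>x\<in>V. \<Sum>v\<in>V. of_bool (R x v) * kpow (Suc p) x v * kpow (q + m) x v)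
      = (\<Sum>x\<in>V. \<Sum>v\<in>V. \<Sum>w\<in>V. \<Sum>z\<in>V.
          of_bool (R x v) * ((normalized_adj x w * kpow p w v) * (kpow q v z * kpow m x z)))"
  proof (intro sum.cong refl)
    fix x v assume "x \<in> V" "v \<in> V"
    then have "kpow (q + m) x v = (\<Sum>z\<in>V. kpow q v z * kpow m x z)"
      by (subst kpow_commute) (auto simp: kpow_add kpow_commute[of x] intro!: sum.cong)
    then show "of_bool (R x v) * kpow (Suc p) x v * kpow (q + m) x v = (\<Sum>w\<in>V. \<Sum>z\<in>V.
        of_bool (R x v) * ((normalized_adj x w * kpow p w v) * (kpow q v z * kpow m x z)))"
      by (simp only: kpow.simps(2) mult.assoc[of "of_bool (R x v)"] sum_product) (simp only: sum_distrib_left)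
  qed
  also have "\<dots> = (\<Sum>x\<in>V. \<Sum>w\<in>V. \<Sum>z\<in>V. f (x, w) z * g (x, w) z)"
  proof (rule sum.cong[OF refl])
    fix x assume x: "x \<in> V"
    have "f (x, w) z * g (x, w) z = normalized_adj x w * kpow m x z * Q x w z" for w z
      by (simp add: f_def g_def normalized_adj_def mult_ac)
    then have fg: "f (x, w) z * g (x, w) z = (\<Sum>v\<in>V. of_bool (R x v) *
        ((normalized_adj x w * kpow p w v) * (kpow q v z * kpow m x z)))" for w z
      unfolding Q_def by (simp only: sum_distrib_left mult_ac)
    show "(\<Sum>v\<in>V. \<Sum>w\<in>V. \<Sum>z\<in>V. of_bool (R x v) *
          ((normalized_adj x w * kpow p w v) * (kpow q v z * kpow m x z)))
        = (\<Sum>w\<in>V. \<Sum>z\<in>V. f (x, w) z * g (x, w) z)"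
      unfolding fg by (rule trans[OF sum.swap]) (rule sum.cong[OF refl sum.swap])
  qed
  also have "\<dots> = (\<Sum>xw\<in>V \<times> V. \<Sum>z\<in>V. f xw z * g xw z)"
    by (simp only: sum.cartesian_product')
  finally have "(\<Sum>x\<in>V. \<Sum>v\<in>V. of_bool (R x v) * kpow (Suc p) x v * kpow (q + m) x v)\<^sup>2
      \<le> (\<Sum>xw\<in>V \<times> V. \<Sum>z\<in>V. (f xw z)\<^sup>2) * (\<Sum>xw\<in>V \<times> V. \<Sum>z\<in>V. (g xw z)\<^sup>2)"
    by (simp only: Cauchy_Schwarz_ineq_sum2)
  \<comment> \<open>No degree bound is spent on \<open>g\<close>: summing the indicator over
    \<open>w\<close> gives exactly \<open>deg x\<close>, which cancels the denominator.\<close>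
  also have "(\<Sum>xw\<in>V \<times> V. \<Sum>z\<in>V. (g xw z)\<^sup>2)
      = (\<Sum>x\<in>V. \<Sum>z\<in>V. \<Sum>w\<in>V. of_bool (adj x w) * ((kpow m x z)\<^sup>2 / deg x))"
  proof -
    have "(\<Sum>xw\<in>V \<times> V. \<Sum>z\<in>V. (g xw z)\<^sup>2) = (\<Sum>x\<in>V. \<Sum>w\<in>V. \<Sum>z\<in>V. (g (x, w) z)\<^sup>2)"
      by (simp only: sum.cartesian_product')
    also have "\<dots> = (\<Sum>x\<in>V. \<Sum>w\<in>V. \<Sum>z\<in>V. of_bool (adj x w) * ((kpow m x z)\<^sup>2 / deg x))"
      using deg_pos by (intro sum.cong refl)
        (auto simp: g_def power_mult_distrib power_divide less_imp_le)
    also have "\<dots> = (\<Sum>x\<in>V. \<Sum>z\<in>V. \<Sum>w\<in>V. of_bool (adj x w) * ((kpow m x z)\<^sup>2 / deg x))"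
      by (intro sum.cong refl sum.swap)
    finally show ?thesis .
  qed
  also have "\<dots> = kernel_trace (2 * m)"
    unfolding kernel_trace_double sum_distrib_right[symmetric] sum_adj
    using deg_pos by (intro sum.cong refl) force
  \<comment> \<open>Only one of the two factors \<open>Q\<close> is enlarged to \<open>P\<close>,
    and \<open>1 / deg w\<close> to \<open>1 / \<delta>\<close>. The other factor \<open>Q\<close>
    keeps the relation, so that the sum over \<open>x\<close> gains \<open>s\<close>.\<close>
  also have "(\<Sum>xw\<in>V \<times> V. \<Sum>z\<in>V. (f xw z)\<^sup>2) \<le> s / \<delta> * kernel_trace (2 * (p + q))"
  proof -
    have "(\<Sum>xw\<in>V \<times> V. \<Sum>z\<in>V. (f xw z)\<^sup>2) = (\<Sum>x\<in>V. \<Sum>w\<in>V. \<Sum>z\<in>V. (f (x, w) z)\<^sup>2)"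
      by (simp only: sum.cartesian_product')
    also have "\<dots> \<le> (\<Sum>x\<in>V. \<Sum>w\<in>V. \<Sum>z\<in>V. of_bool (adj x w) * Q x w z * (P w z / \<delta>))"
    proof (intro sum_mono)
      fix x w z assume w: "w \<in> V"
      have "(f (x, w) z)\<^sup>2 = of_bool (adj x w) * Q x w z * (Q x w z / deg w)"
        using deg_pos[OF w] by (simp add: f_def power_mult_distrib power_divide power2_eq_square)
      also have "\<dots> \<le> of_bool (adj x w) * Q x w z * (P w z / \<delta>)"
        using min_degree[OF w] min_degree_pos Q_nonneg P_nonneg
        by (intro mult_left_mono frac_le Q_le_P mult_nonneg_nonneg) (auto simp: deg_def)
      finally show "(f (x, w) z)\<^sup>2 \<le> of_bool (adj x w) * Q x w z * (P w z / \<delta>)" .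
    qed
    also have "\<dots> = (\<Sum>w\<in>V. \<Sum>z\<in>V. (\<Sum>x\<in>V. of_bool (adj x w) * Q x w z) * (P w z / \<delta>))"
      unfolding sum_distrib_right by (subst sum.swap) (intro sum.cong refl sum.swap)
    also have "\<dots> \<le> (\<Sum>w\<in>V. \<Sum>z\<in>V. s * P w z * (P w z / \<delta>))"
      using min_degree_pos P_nonneg by (intro sum_mono mult_right_mono sum_Q) auto
    also have "\<dots> = s / \<delta> * kernel_trace (2 * (p + q))"
      unfolding kernel_trace_double sum_distrib_left
      by (intro sum.cong refl) (simp add: P_eq power2_eq_square)
    finally show ?thesis .
  qed
  finally show ?thesis
    using kernel_trace_ge_1[of m] by (simp add: mult_right_mono)
qed

text \<open>Otherwise a union bound over pairs of positions bounds the trace of order 2k by a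
  multiple of that of order 2(k - 1). Iterating the ratio bound then pushes it below 1, against
  \<open>kernel_trace_ge_1\<close>.\<close>

theorem exists_unrelated_closed_walk:
  assumes k: "0 < k" and few: "(16 * real k ^ 4 * s / \<delta>) ^ k * card V < 1"
  shows "\<exists>xs. set xs \<subseteq> V \<and> length xs = 2 * k \<and>
    (\<forall>i<2 * k. adj (xs ! i) (xs ! (Suc i mod (2 * k)))) \<and>
    (\<forall>j<2 * k. \<forall>i<j. \<not> R (xs ! i) (xs ! j))"
proof (rule ccontr)
  assume contra: "\<not> ?thesis"
  obtain k' where k': "k = Suc k'" using k gr0_conv_Suc by blast
  define M where "M = sqrt (s / \<delta> * kernel_trace (2 * k) * kernel_trace (2 * k'))"
  have s: "0 \<le> s"
    using nonempty sparse by (meson all_not_in_conv of_nat_0_le_iff order_trans)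
  note ge1 = kernel_trace_ge_1
  have M: "0 \<le> M"
    unfolding M_def using s min_degree_pos ge1[of k] ge1[of k'] by simp
  have M2: "M\<^sup>2 = s / \<delta> * kernel_trace (2 * k) * kernel_trace (2 * k')"
    unfolding M_def using s min_degree_pos ge1[of k] ge1[of k'] by simp
  \<comment> \<open>The weight of the closed walks of length 2k whose vertices at positions 0 and
    \<open>l\<close> are related.\<close>
  define bad where "bad l = (\<Sum>x\<in>V. \<Sum>v\<in>V. of_bool (R x v) * kpow l x v * kpow (2 * k - l) x v)" for l
  have short: "bad l \<le> M" if "0 < l" "l \<le> k" for l
  proof -
    have "(bad l)\<^sup>2 \<le> s / \<delta> * kernel_trace (2 * k) * kernel_trace (2 * k')"
    proof -
      \<comment> \<open>The split of the long arc is chosen so that the two traces produced have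
        orders 2k and 2(k - 1).\<close>
      have "Suc (l - 1) = l" "k - l + 1 + k' = 2 * k - l" "l - 1 + (k - l + 1) = k"
        using that k' by auto
      then show ?thesis
        using related_pair_bound[of "l - 1" "k - l + 1" k'] by (simp only: bad_def)
    qed
    then show ?thesis
      unfolding M_def by (rule real_le_rsqrt)
  qed
  have bad_le: "bad l \<le> M" if "0 < l" "l < 2 * k" for l
  proof (cases "l \<le> k")
    case False
    \<comment> \<open>The two arcs between the related vertices play symmetric parts, so the shorter
      one may be used.\<close>
    have "bad l = bad (2 * k - l)"
      using that by (simp add: bad_def mult_ac)
    then show ?thesis using short[of "2 * k - l"] False that by simp
  qed (use short that in auto)
  have "kernel_trace (2 * k) = (\<Sum>xs\<in>walks (2 * k). closed_weight xs)"
    using k by (intro kernel_trace_eq_sum_closed_weight) simp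
  \<comment> \<open>A walk of nonzero weight follows adjacencies, so by assumption it has a related
    pair and is counted at least once on the right.\<close>
  also have "\<dots> \<le> (\<Sum>xs\<in>walks (2 * k). \<Sum>j<2 * k. \<Sum>i<j. of_bool (R (xs ! i) (xs ! j)) * closed_weight xs)"
  proof (rule sum_mono)
    fix xs assume xs: "xs \<in> walks (2 * k)"
    have cw: "0 \<le> closed_weight xs"
      by (simp add: closed_weight_def walk_weight_nonneg)
    have nn: "0 \<le> of_bool (R (xs ! i) (xs ! j)) * closed_weight xs" for i j
      using cw by simp
    show "closed_weight xs \<le> (\<Sum>j<2 * k. \<Sum>i<j. of_bool (R (xs ! i) (xs ! j)) * closed_weight xs)"
    proof (cases "closed_weight xs = 0")
      case True
      then show ?thesis using nn by (simp add: sum_nonneg)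
    next
      case False
      have "adj (xs ! i) (xs ! (Suc i mod (2 * k)))" if "i < 2 * k" for i
        using closed_weight_pos_nth[OF False, of i] xs that by (auto simp: normalized_adj_def)
      then obtain i j where ij: "j < 2 * k" "i < j" "R (xs ! i) (xs ! j)"
        using contra xs by blast
      have "closed_weight xs = of_bool (R (xs ! i) (xs ! j)) * closed_weight xs"
        using ij by simp
      also have "\<dots> \<le> (\<Sum>i<j. of_bool (R (xs ! i) (xs ! j)) * closed_weight xs)"
        using ij nn by (intro member_le_sum) auto
      also have "\<dots> \<le> (\<Sum>j<2 * k. \<Sum>i<j. of_bool (R (xs ! i) (xs ! j)) * closed_weight xs)"
        using ij nn by (intro member_le_sum[of j "{..<2 * k}" "\<lambda>j. \<Sum>i<j. of_bool (R (xs ! i) (xs ! j)) * closed_weight xs"])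
          (auto intro!: sum_nonneg simp del: sum_mult_of_bool_eq sum_of_bool_mult_eq)
      finally show ?thesis .
    qed
  qed
  also have "\<dots> = (\<Sum>j<2 * k. \<Sum>i<j. \<Sum>xs\<in>walks (2 * k). of_bool (R (xs ! i) (xs ! j)) * closed_weight xs)"
    by (subst sum.swap) (intro sum.cong refl sum.swap)
  also have "\<dots> = (\<Sum>j<2 * k. \<Sum>i<j. bad (j - i))"
    unfolding bad_def
    by (intro sum.cong refl sum_closed_weight_rotate[where c = "\<lambda>x y. of_bool (R x y)"]) auto
  also have "\<dots> \<le> (\<Sum>j<2 * k. \<Sum>i<j. M)"
    using bad_le by (intro sum_mono) auto
  \<comment> \<open>Each \<open>j\<close> has at most 2k smaller positions \<open>i\<close>;
    squaring the resulting 4k^2 gives the constant 16k^4.\<close>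
  also have "\<dots> \<le> (\<Sum>j<2 * k. real (2 * k) * M)"
    using M by (intro sum_mono) (auto intro!: mult_right_mono)
  also have "\<dots> = 4 * real k ^ 2 * M"
    by (simp add: power2_eq_square)
  finally have "kernel_trace (2 * k) \<le> 4 * real k ^ 2 * M" .
  then have "(kernel_trace (2 * k))\<^sup>2 \<le> (4 * real k ^ 2 * M)\<^sup>2"
    using ge1[of k] by (intro power_mono) auto
  also have "\<dots> = 16 * real k ^ 4 * s / \<delta> * kernel_trace (2 * k') * kernel_trace (2 * k)"
    by (simp add: power_mult_distrib M2)
  finally have "kernel_trace (2 * k) * kernel_trace (2 * k)
      \<le> 16 * real k ^ 4 * s / \<delta> * kernel_trace (2 * k') * kernel_trace (2 * k)"
    by (simp add: power2_eq_square)
  then have "kernel_trace (2 * k) \<le> 16 * real k ^ 4 * s / \<delta> * kernel_trace (2 * k')"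
    using ge1[of k] by (simp only: mult_le_cancel_right_pos)
  then have "kernel_trace (2 * k) \<le> (16 * real k ^ 4 * s / \<delta>) ^ k * card V"
    unfolding k' using ge1 by (intro kernel_trace_le_power) (auto intro: less_le_trans[OF zero_less_one])
  then show False
    using few ge1[of k] by linarith
qed

end

section \<open>Tuples of vertices and repeated cycles\<close>

text \<open>\<open>W\<close> maximizes the number of ordered edges minus
  \<open>2 * \<delta> * card W\<close>. Deleting a vertex of degree below \<open>\<delta>\<close>
  would increase this quantity, and its maximum is positive, which excludes the empty set.\<close>

lemma dense_graph_has_min_degree_subset:
  fixes adj :: "'a \<Rightarrow> 'a \<Rightarrow> bool" and \<delta> :: real
  assumes V: "finite V" and adj: "\<And>x y. adj x y \<longleftrightarrow> adj y x"
    and dense: "2 * \<delta> * card V < card {(x, y) \<in> V \<times> V. adj x y}"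
  obtains W where "W \<subseteq> V" "W \<noteq> {}" "\<And>x. x \<in> W \<Longrightarrow> \<delta> \<le> card {y \<in> W. adj x y}"
proof -
  define E where "E W = {(x, y) \<in> W \<times> W. adj x y}" for W
  define \<Phi> where "\<Phi> W = real (card (E W)) - 2 * \<delta> * card W" for W
  have "Max (\<Phi> ` Pow V) \<in> \<Phi> ` Pow V"
    using V by (intro Max_in) auto
  then obtain W where W: "W \<subseteq> V" and "\<Phi> W = Max (\<Phi> ` Pow V)"
    by auto
  then have max: "\<Phi> U \<le> \<Phi> W" if "U \<subseteq> V" for U
    using V that by simp
  have "0 < \<Phi> V" using dense by (simp add: \<Phi>_def E_def)
  then have "0 < \<Phi> W" using max[of V] by simp
  then have "W \<noteq> {}" by (auto simp: \<Phi>_def E_def)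
  moreover have "\<delta> \<le> card {y \<in> W. adj x y}" if x: "x \<in> W" for x
  proof -
    let ?N = "{y \<in> W. adj x y}"
    have fin: "finite W" using W V by (rule finite_subset)
    \<comment> \<open>An ordered edge lost with \<open>x\<close> has \<open>x\<close> as its first
      or second entry, which explains the factor 2 in the density hypothesis.\<close>
    have "E W \<subseteq> E (W - {x}) \<union> (Pair x ` ?N \<union> (\<lambda>y. (y, x)) ` ?N)"
      using adj by (auto simp: E_def)
    moreover have "finite (E (W - {x}))"
      by (rule finite_subset[of _ "W \<times> W"]) (use fin in \<open>auto simp: E_def\<close>)
    ultimately have "card (E W) \<le> card (E (W - {x}) \<union> (Pair x ` ?N \<union> (\<lambda>y. (y, x)) ` ?N))"
      using fin by (intro card_mono) auto
    also have "\<dots> \<le> card (E (W - {x})) + (card (Pair x ` ?N) + card ((\<lambda>y. (y, x)) ` ?N))"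
      by (meson card_Un_le add_left_mono order_trans)
    also have "\<dots> \<le> card (E (W - {x})) + (card ?N + card ?N)"
      using fin by (intro add_mono card_image_le order_refl) auto
    finally have "real (card (E W)) \<le> real (card (E (W - {x}))) + 2 * real (card ?N)"
      by linarith
    moreover have "\<Phi> (W - {x}) \<le> \<Phi> W"
      using W by (intro max) auto
    moreover have "real (card W) = real (card (W - {x})) + 1"
      using card_Suc_Diff1[OF fin x] by linarith
    ultimately show ?thesis
      by (simp add: \<Phi>_def algebra_simps)
  qed
  ultimately show ?thesis using that W by blast
qed

section \<open>Colour-isomorphic cycles from an array of vertices\<close>

lemma graph_iso_image:
  assumes "inj_on g A" "E \<subseteq> Pow A"
  shows "graph_iso (A, E) (g ` A, (`) g ` E) g"
proof -
  have "{a, b} \<in> E \<longleftrightarrow> {g a, g b} \<in> (`) g ` E" if "a \<in> A" "b \<in> A" for a b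
  proof
    assume "{g a, g b} \<in> (`) g ` E"
    then obtain e where e: "e \<in> E" "g ` {a, b} = g ` e" by auto
    then have "{a, b} = e"
      using inj_on_image_eq_iff[OF assms(1), of "{a, b}" e] that assms(2) by auto
    with e show "{a, b} \<in> E" by simp
  qed (metis image_empty image_insert imageI)
  then show ?thesis
    using assms(1) by (auto simp: graph_iso_def bij_betw_def)
qed

text \<open>Row \<open>i\<close> of the array is the \<open>i\<close>-th cycle. Joint injectivity
  makes the rows both embedded and disjoint, and equal colours along each column make the row-to-row
  map a colour isomorphism.\<close>

lemma has_r_copies_cycleI:
  fixes h :: "nat \<Rightarrow> nat \<Rightarrow> nat"
  assumes m: "2 \<le> m"
    and inj: "\<And>i i' j j'. i < r \<Longrightarrow> i' < r \<Longrightarrow> j < m \<Longrightarrow> j' < m \<Longrightarrow> h i j = h i' j' \<Longrightarrow> i = i' \<and> j = j'"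
    and bound: "\<And>i j. i < r \<Longrightarrow> j < m \<Longrightarrow> h i j < n"
    and col: "\<And>i i' j. i < r \<Longrightarrow> i' < r \<Longrightarrow> j < m \<Longrightarrow>
      col {h i j, h i (Suc j mod m)} = col {h i' j, h i' (Suc j mod m)}"
  shows "has_r_copies r n (cycle_graph m) col"
proof -
  define E where "E = snd (cycle_graph m)"
  have E: "E = {{i, Suc i mod m} | i. i < m}" and cyc: "cycle_graph m = ({..<m}, E)"
    by (simp_all add: E_def cycle_graph_def)
  have E_sub: "E \<subseteq> Pow {..<m}"
    using m by (auto simp: E)
  define S where "S i = (h i ` {..<m}, (`) (h i) ` E)" for i
  have inj_h: "inj_on (h i) {..<m}" if "i < r" for i
    using inj that by (auto simp: inj_on_def)
  have iso: "graph_iso (cycle_graph m) (S i) (h i)" if "i < r" for i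
    unfolding cyc S_def using inj_h[OF that] E_sub by (rule graph_iso_image)
  have suc: "j \<noteq> Suc j mod m" if "j < m" for j
    using that m by (cases "Suc j = m") auto
  have "is_copy n (cycle_graph m) (S i)" if i: "i < r" for i
  proof -
    have "fst (S i) \<subseteq> {..<n}"
      using bound i by (auto simp: S_def)
    moreover have "snd (S i) \<subseteq> {{a, b} | a b. a \<in> fst (S i) \<and> b \<in> fst (S i) \<and> a \<noteq> b}"
    proof
      fix e assume "e \<in> snd (S i)"
      then obtain j where j: "j < m" "e = {h i j, h i (Suc j mod m)}"
        by (auto simp: S_def E)
      moreover have "h i j \<noteq> h i (Suc j mod m)"
        using inj[OF i i, of j "Suc j mod m"] suc[of j] j(1) m by auto
      moreover have "h i j \<in> fst (S i)" "h i (Suc j mod m) \<in> fst (S i)"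
        using j(1) m by (auto simp: S_def)
      ultimately show "e \<in> {{a, b} | a b. a \<in> fst (S i) \<and> b \<in> fst (S i) \<and> a \<noteq> b}"
        by blast
    qed
    ultimately show ?thesis
      using iso[OF i] by (auto simp: is_copy_def subgraph_Kn_def)
  qed
  moreover have "fst (S i) \<inter> fst (S i') = {}" if "i < r" "i' < r" "i \<noteq> i'" for i i'
    using inj that by (fastforce simp: S_def)
  moreover have "colour_iso col (S i) (S i')" if i: "i < r" "i' < r" for i i'
  proof -
    \<comment> \<open>The map sends each vertex of row \<open>i\<close> to the vertex of row
      \<open>i'\<close> in the same column.\<close>
    define g where "g = h i' \<circ> the_inv_into {..<m} (h i)"
    have g: "g (h i j) = h i' j" if "j < m" for j
      using inj_h[OF i(1)] that by (simp add: g_def the_inv_into_f_f)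
    have "inj_on g (h i ` {..<m})"
      using g inj_h[OF i(2)] by (auto simp: inj_on_def)
    then have "graph_iso (S i) (g ` h i ` {..<m}, (`) g ` (`) (h i) ` E) g"
      unfolding S_def using E_sub by (intro graph_iso_image) auto
    moreover have "g ` h i ` {..<m} = h i' ` {..<m}"
      using g by (auto simp: image_image)
    moreover have "(`) g ` (`) (h i) ` E = (`) (h i') ` E"
      unfolding image_image
    proof (rule image_cong[OF refl])
      fix e assume "e \<in> E"
      then show "(\<lambda>x. g (h i x)) ` e = h i' ` e"
        using E_sub g by (intro image_cong refl) auto
    qed
    ultimately have "graph_iso (S i) (S i') g"
      by (simp add: S_def)
    moreover have "col {g a, g b} = col {a, b}" if ab: "{a, b} \<in> snd (S i)" for a b
    proof -
      obtain j where j: "j < m" "{a, b} = {h i j, h i (Suc j mod m)}"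
        using ab by (auto simp: S_def E)
      have "{g a, g b} = g ` {h i j, h i (Suc j mod m)}"
        using j(2) by (metis image_empty image_insert)
      also have "\<dots> = {h i' j, h i' (Suc j mod m)}"
        using j(1) m by (simp add: g)
      finally show ?thesis
        using j col[OF i(2) i(1) j(1)] by simp
    qed
    ultimately show ?thesis by (auto simp: colour_iso_def)
  qed
  ultimately show ?thesis
    unfolding has_r_copies_def by blast
qed

section \<open>The graph of tuples and its local sparseness\<close>

definition tuples :: "nat \<Rightarrow> nat \<Rightarrow> nat list set" where
  "tuples n r = {xs. length xs = r \<and> distinct xs \<and> set xs \<subseteq> {..<n}}"

text \<open>Distinctness of the concatenation makes the joining edges a monochromatic
  matching.\<close>

definition parallel :: "(nat set \<Rightarrow> nat) \<Rightarrow> nat list \<Rightarrow> nat list \<Rightarrow> bool" where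
  "parallel col xs ys \<longleftrightarrow> length xs = length ys \<and> distinct (xs @ ys) \<and>
    (\<exists>c. \<forall>i<length xs. col {xs ! i, ys ! i} = c)"

lemma parallel_commute: "parallel col xs ys \<longleftrightarrow> parallel col ys xs"
  unfolding parallel_def by (auto simp: insert_commute)

lemma parallelD:
  "parallel col xs ys \<Longrightarrow> i < length xs \<Longrightarrow> j < length xs \<Longrightarrow> col {xs ! i, ys ! i} = col {xs ! j, ys ! j}"
  unfolding parallel_def by auto

lemma finite_tuples: "finite (tuples n r)"
  by (rule finite_subset[OF _ finite_lists_length_eq[of "{..<n}" r]]) (auto simp: tuples_def)

lemma card_tuples_le: "card (tuples n r) \<le> n ^ r"
proof -
  have "card (tuples n r) \<le> card {xs. set xs \<subseteq> {..<n} \<and> length xs = r}"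
    by (intro card_mono finite_lists_length_eq) (auto simp: tuples_def)
  then show ?thesis by (simp add: card_lists_length_eq)
qed

text \<open>The shared entry fixes the colour of the matching, and a proper colouring has at most
  one edge of that colour at each entry of \<open>y\<close>.\<close>

lemma parallel_determined:
  assumes proper: "proper_colouring n col"
    and "y \<in> tuples n r" "z \<in> tuples n r" "z' \<in> tuples n r"
    and "parallel col y z" "parallel col y z'" "i < r" "z ! i = z' ! i"
  shows "z = z'"
proof (rule nth_equalityI)
  show "length z = length z'" using assms by (simp add: tuples_def)
  fix l assume "l < length z"
  with assms have l: "l < r" "length y = r" "length z = r" "length z' = r"
    by (auto simp: tuples_def)
  have "col {y ! l, z ! l} = col {y ! i, z ! i}"
    using assms l by (intro parallelD) auto
  also have "\<dots> = col {y ! l, z' ! l}"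
    using assms l by (metis parallelD)
  finally have *: "col {y ! l, z ! l} = col {y ! l, z' ! l}" .
  have "y ! l \<in> set y" "z ! l \<in> set z" "z' ! l \<in> set z'"
    using l by auto
  then have "y ! l < n" "z ! l < n" "z' ! l < n" "y ! l \<noteq> z ! l" "y ! l \<noteq> z' ! l"
    using assms(2-6) by (auto simp: tuples_def parallel_def)
  then show "z ! l = z' ! l"
    using proper * unfolding proper_colouring_def by blast
qed

text \<open>Meeting \<open>x\<close> means that some entry of \<open>z\<close> equals some entry of
  \<open>x\<close>; each of the r^2 pairs of positions admits at most one neighbour
  \<open>z\<close>.\<close>

lemma card_parallel_meeting_le:
  assumes proper: "proper_colouring n col" and x: "x \<in> tuples n r" and y: "y \<in> tuples n r"
  shows "card {z \<in> tuples n r. parallel col y z \<and> set x \<inter> set z \<noteq> {}} \<le> r\<^sup>2"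
proof -
  define F where "F p = {z \<in> tuples n r. parallel col y z \<and> z ! fst p = x ! snd p}" for p
  have F: "card (F p) \<le> 1" if "p \<in> {..<r} \<times> {..<r}" for p
    using that parallel_determined[OF proper y]
    by (intro card_le_Suc0_iff_eq[THEN iffD2, unfolded One_nat_def[symmetric]])
      (auto simp: F_def finite_tuples)
  have "{z \<in> tuples n r. parallel col y z \<and> set x \<inter> set z \<noteq> {}} \<subseteq> (\<Union>p\<in>{..<r} \<times> {..<r}. F p)"
  proof
    fix z assume z: "z \<in> {z \<in> tuples n r. parallel col y z \<and> set x \<inter> set z \<noteq> {}}"
    then obtain w where "w \<in> set x" "w \<in> set z" by auto
    then obtain i j where "i < length z" "z ! i = w" "j < length x" "x ! j = w"
      by (auto simp: in_set_conv_nth)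
    then have "z \<in> F (i, j)" "(i, j) \<in> {..<r} \<times> {..<r}"
      using x z by (auto simp: F_def tuples_def)
    then show "z \<in> (\<Union>p\<in>{..<r} \<times> {..<r}. F p)" by blast
  qed
  then have "card {z \<in> tuples n r. parallel col y z \<and> set x \<inter> set z \<noteq> {}}
      \<le> card (\<Union>p\<in>{..<r} \<times> {..<r}. F p)"
    by (intro card_mono) (auto simp: F_def finite_tuples)
  also have "\<dots> \<le> (\<Sum>p\<in>{..<r} \<times> {..<r}. card (F p))"
    by (intro card_UN_le) auto
  also have "\<dots> \<le> (\<Sum>p\<in>{..<r} \<times> {..<r}. 1)"
    using F by (intro sum_mono) auto
  finally show ?thesis by (simp add: power2_eq_square)
qed

text \<open>A falling factorial is bounded linearly in \<open>card A\<close>, so that a sum over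
  colour classes needs only their total size. Below the threshold \<open>\<theta>\<close> the left
  side is not positive.\<close>

lemma card_distinct_lists_ge:
  fixes \<theta> :: real
  assumes "finite A" "0 < r" "2 * real r \<le> \<theta>"
  shows "\<theta> ^ (r - 1) / 2 ^ r * (card A - \<theta>)
    \<le> card {es. length es = r \<and> distinct es \<and> set es \<subseteq> A}"
proof (cases "\<theta> \<le> card A")
  case True
  let ?m = "card A"
  have r: "r \<le> ?m" "2 * real r \<le> ?m" using assms True by auto
  have "\<theta> ^ (r - 1) / 2 ^ r * (?m - \<theta>) \<le> \<theta> ^ (r - 1) / 2 ^ r * ?m"
    using assms by (intro mult_left_mono) auto
  also have "\<dots> \<le> real ?m ^ (r - 1) / 2 ^ r * ?m"
    using assms True by (intro mult_right_mono divide_right_mono power_mono) auto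
  also have "\<dots> = (real ?m / 2) ^ r"
    using assms(2) by (cases r) (auto simp: power_divide)
  \<comment> \<open>Each of the r factors is at least half of the largest, since
    \<open>2 * r \<le> card A\<close>.\<close>
  also have "\<dots> = (\<Prod>x\<in>{?m - r + 1..?m}. real ?m / 2)"
    using r by simp
  also have "\<dots> \<le> (\<Prod>x\<in>{?m - r + 1..?m}. real x)"
    using r by (intro prod_mono) (auto simp: field_simps)
  also have "\<dots> = card {es. length es = r \<and> distinct es \<and> set es \<subseteq> A}"
    using assms(1) r by (simp add: card_lists_distinct_length_eq)
  finally show ?thesis .
next
  case False
  then have "\<theta> ^ (r - 1) / 2 ^ r * (card A - \<theta>) \<le> 0"
    using assms by (intro mult_nonneg_nonpos) auto
  then show ?thesis by (meson of_nat_0_le_iff order_trans)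
qed

lemma finite_Kn_edges: "finite (Kn_edges n)"
  by (rule finite_subset[of _ "Pow {..<n}"]) (auto simp: Kn_edges_def)

text \<open>A list of r distinct edges of one colour is a monochromatic matching and yields an
  adjacent pair of tuples. The linear bound for such lists is summed over all colours.\<close>

lemma card_parallel_ge:
  fixes \<theta> :: real
  assumes proper: "proper_colouring n col" and n: "2 \<le> n" and r: "0 < r"
    and \<theta>: "2 * real r \<le> \<theta>" "8 * real (num_colours n col) * \<theta> \<le> (real n)\<^sup>2"
  shows "\<theta> ^ (r - 1) * (real n)\<^sup>2 / 2 ^ (r + 3)
    \<le> card {(x, y) \<in> tuples n r \<times> tuples n r. parallel col x y}"
proof -
  define C where "C = col ` Kn_edges n"
  \<comment> \<open>Edges of colour \<open>c\<close>, oriented with the larger end first so that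
    each occurs once.\<close>
  define M where "M c = {(b, a). b < n \<and> a < b \<and> col {b, a} = c}" for c
  define T where "T c = {es. length es = r \<and> distinct es \<and> set es \<subseteq> M c}" for c
  define P where "P c = (\<lambda>es. (map fst es, map snd es)) ` T c" for c
  have finC: "finite C"
    by (simp add: C_def finite_Kn_edges)
  have finM: "finite (M c)" for c
    by (rule finite_subset[of _ "{..<n} \<times> {..<n}"]) (auto simp: M_def)
  have finT: "finite (T c)" for c
    by (rule finite_subset[OF _ finite_lists_length_eq[OF finM, of c r]]) (auto simp: T_def)
  have same: "b = d" if "col {a, b} = col {a, d}" "a < n" "b < n" "d < n" "a \<noteq> b" "a \<noteq> d" for a b d
    using proper that unfolding proper_colouring_def by blast
  have M_D: "fst p < n \<and> snd p < fst p \<and> col {fst p, snd p} = c" if "p \<in> M c" for p c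
    using that by (auto simp: M_def)
  have M_fst: "inj_on fst (M c)" for c
    using same by (fastforce simp: inj_on_def M_def)
  have M_snd: "inj_on snd (M c)" for c
  proof (rule inj_onI)
    fix p q assume pq: "p \<in> M c" "q \<in> M c" and eq: "snd p = snd q"
    have "fst p = fst q"
    proof (rule same)
      show "col {snd p, fst p} = col {snd p, fst q}"
        using pq[THEN M_D] eq by (simp add: insert_commute)
    qed (use pq[THEN M_D] eq in auto)
    with eq show "p = q" by (rule prod_eqI[rotated])
  qed
  \<comment> \<open>If two edges met head to tail, properness would make them the same edge with
    both orientations, against the order of the ends.\<close>
  have M_disj: "fst p \<noteq> snd q" if pq: "p \<in> M c" "q \<in> M c" for p q c
  proof
    assume eq: "fst p = snd q"
    have "snd p = fst q"
    proof (rule same)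
      show "col {fst p, snd p} = col {fst p, fst q}"
        using pq[THEN M_D] eq by (simp add: insert_commute)
    qed (use pq[THEN M_D] eq in auto)
    then show False using pq[THEN M_D] eq by simp
  qed
  have P_sub: "P c \<subseteq> {(x, y) \<in> tuples n r \<times> tuples n r. parallel col x y}" for c
  proof
    fix xy assume "xy \<in> P c"
    then obtain es where es: "length es = r" "distinct es" "set es \<subseteq> M c"
        and xy: "xy = (map fst es, map snd es)"
      by (auto simp: P_def T_def)
    have "distinct (map fst es)" "distinct (map snd es)"
      using es M_fst[of c] M_snd[of c] by (auto simp: distinct_map intro: inj_on_subset)
    moreover have "set (map fst es) \<subseteq> {..<n}" "set (map snd es) \<subseteq> {..<n}"
      using es(3) by (auto simp: M_def)
    moreover have "set (map fst es) \<inter> set (map snd es) = {}"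
      using M_disj es(3) by fastforce
    moreover have "col {fst (es ! i), snd (es ! i)} = c" if "i < length es" for i
      using nth_mem[OF that] es(3) by (auto simp: M_def)
    ultimately show "xy \<in> {(x, y) \<in> tuples n r \<times> tuples n r. parallel col x y}"
      using es(1) by (auto simp: xy tuples_def parallel_def)
  qed
  have card_P: "card (P c) = card (T c)" for c
    unfolding P_def by (intro card_image inj_onI) (metis Pair_inject zip_map_fst_snd)
  have P_disj: "P c \<inter> P c' = {}" if "c \<noteq> c'" for c c'
  proof (rule ccontr)
    assume "P c \<inter> P c' \<noteq> {}"
    then obtain es es' where *: "es \<in> T c" "es' \<in> T c'" "map fst es = map fst es'" "map snd es = map snd es'"
      by (auto simp: P_def)
    then have "es = es'" by (metis zip_map_fst_snd)
    moreover have "es \<noteq> []" using * r by (auto simp: T_def)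
    ultimately have "hd es \<in> M c \<inter> M c'" using * by (auto simp: T_def)
    with that show False by (auto simp: M_def)
  qed
  have "col {b, a} \<in> C" if "b < n" "a < b" for a b
    unfolding C_def Kn_edges_def using that by (intro imageI CollectI exI[of _ b] exI[of _ a]) auto
  then have "(\<Union>c\<in>C. M c) = Sigma {..<n} lessThan"
    by (auto simp: M_def)
  then have "(\<Sum>c\<in>C. card (M c)) = (\<Sum>b<n. b)"
    using finC finM by (subst card_UN_disjoint[symmetric]) (auto simp: M_def)
  moreover have "real (\<Sum>b<n. b) = real n * (real n - 1) / 2"
    by (induction n) (auto simp: field_simps)
  ultimately have sum_M: "(\<Sum>c\<in>C. real (card (M c))) = real n * (real n - 1) / 2"
    by (metis of_nat_sum)
  have "real n * 2 \<le> real n * real n"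
    using n by (intro mult_left_mono) auto
  then have half: "(real n)\<^sup>2 / 4 \<le> (\<Sum>c\<in>C. real (card (M c)))"
    unfolding sum_M by (simp add: power2_eq_square field_simps)
  \<comment> \<open>There are at least n^2/4 edges, and the thresholds \<open>\<theta>\<close> of
    all colours together cost at most n^2/8.\<close>
  have "\<theta> ^ (r - 1) * (real n)\<^sup>2 / 2 ^ (r + 3) = \<theta> ^ (r - 1) / 2 ^ r * ((real n)\<^sup>2 / 4 - (real n)\<^sup>2 / 8)"
    by (simp add: power_add field_simps)
  also have "\<dots> \<le> \<theta> ^ (r - 1) / 2 ^ r * (\<Sum>c\<in>C. real (card (M c)) - \<theta>)"
    using half \<theta> by (intro mult_left_mono) (auto simp: sum_subtractf num_colours_def C_def)
  also have "\<dots> \<le> (\<Sum>c\<in>C. real (card (T c)))"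
    unfolding sum_distrib_left T_def using finM r \<theta>(1) by (intro sum_mono card_distinct_lists_ge)
  also have "\<dots> = card (\<Union>c\<in>C. P c)"
    using finC finT P_disj by (subst card_UN_disjoint) (auto simp: card_P, auto simp: P_def)
  also have "\<dots> \<le> card {(x, y) \<in> tuples n r \<times> tuples n r. parallel col x y}"
    using P_sub by (intro of_nat_mono card_mono)
      (auto intro: finite_subset[OF _ finite_cartesian_product[OF finite_tuples finite_tuples]])
  finally show ?thesis .
qed

text \<open>The hypothesis \<open>large\<close> is the smallness condition of
  \<open>exists_unrelated_closed_walk\<close> for the tuple graph, with the number of vertices
  replaced by its bound n^r.\<close>

lemma has_r_copies_of_few_colours:
  fixes \<theta> :: real
  assumes proper: "proper_colouring n col" and n: "2 \<le> n" and r: "0 < r" and k: "0 < k"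
    and \<theta>: "2 * real r \<le> \<theta>" "8 * real (num_colours n col) * \<theta> \<le> (real n)\<^sup>2"
    and large: "(2 ^ (r + 9) * real k ^ 4 * (real r)\<^sup>2 / (\<theta> ^ (r - 1) * (real n)\<^sup>2 / real n ^ r)) ^ k
      * real n ^ r < 1"
  shows "has_r_copies r n (cycle_graph (2 * k)) col"
proof -
  define A where "A = \<theta> ^ (r - 1) * (real n)\<^sup>2 / real n ^ r"
  \<comment> \<open>This makes \<open>2 * \<delta> * n ^ r\<close> half of the lower bound for the
    adjacent pairs, hence strictly smaller; the factor 16 then turns 2^(r+5) into 2^(r+9).\<close>
  define \<delta> where "\<delta> = A / 2 ^ (r + 5)"
  have \<theta>_pos: "0 < \<theta>" using \<theta>(1) r by (smt (verit) of_nat_0_less_iff)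
  have A: "0 < A" using \<theta>_pos n by (simp add: A_def)
  then have \<delta>: "0 < \<delta>" by (simp add: \<delta>_def)
  have "2 * \<delta> * card (tuples n r) \<le> 2 * \<delta> * real n ^ r"
    using \<delta> card_tuples_le[of n r] by (intro mult_left_mono) (auto simp flip: of_nat_power)
  also have "\<dots> = \<theta> ^ (r - 1) * (real n)\<^sup>2 / 2 ^ (r + 4)"
    using n by (simp add: \<delta>_def A_def power_add)
  also have "\<dots> < \<theta> ^ (r - 1) * (real n)\<^sup>2 / 2 ^ (r + 3)"
    using \<theta>_pos n by (intro divide_strict_left_mono) auto
  also have "\<dots> \<le> card {(x, y) \<in> tuples n r \<times> tuples n r. parallel col x y}"
    using proper n r \<theta> by (rule card_parallel_ge)
  finally obtain W where W: "W \<subseteq> tuples n r" "W \<noteq> {}"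
      and deg: "\<And>x. x \<in> W \<Longrightarrow> \<delta> \<le> card {y \<in> W. parallel col x y}"
    by (rule dense_graph_has_min_degree_subset[OF finite_tuples parallel_commute]) blast
  have finW: "finite W" using W(1) finite_tuples by (rule finite_subset)
  interpret sparse_relation_graph W "parallel col" \<delta> "\<lambda>x y. set x \<inter> set y \<noteq> {}" "(real r)\<^sup>2"
  proof
    show "parallel col x y = parallel col y x" for x y by (rule parallel_commute)
    show "\<delta> \<le> card {y \<in> W. parallel col x y}" if "x \<in> W" for x using that by (rule deg)
    show "card {z \<in> W. parallel col y z \<and> set x \<inter> set z \<noteq> {}} \<le> (real r)\<^sup>2"
      if "x \<in> W" "y \<in> W" for x y
    proof -
      have "card {z \<in> W. parallel col y z \<and> set x \<inter> set z \<noteq> {}}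
          \<le> card {z \<in> tuples n r. parallel col y z \<and> set x \<inter> set z \<noteq> {}}"
        using W(1) by (intro card_mono) (auto simp: finite_tuples)
      also have "\<dots> \<le> r\<^sup>2"
        using that W(1) by (intro card_parallel_meeting_le[OF proper]) auto
      finally show ?thesis by (simp flip: of_nat_power)
    qed
  qed (use finW W \<delta> in auto)
  have "card W \<le> n ^ r"
    using card_mono[OF finite_tuples W(1)] card_tuples_le[of n r] by linarith
  then have cW: "real (card W) \<le> real n ^ r"
    by (simp flip: of_nat_power)
  have "16 * real k ^ 4 * (real r)\<^sup>2 / \<delta> = 2 ^ (r + 9) * real k ^ 4 * (real r)\<^sup>2 / A"
    using A by (simp add: \<delta>_def power_add)
  then have "(16 * real k ^ 4 * (real r)\<^sup>2 / \<delta>) ^ k * card W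
      = (2 ^ (r + 9) * real k ^ 4 * (real r)\<^sup>2 / A) ^ k * card W" by simp
  also have "\<dots> \<le> (2 ^ (r + 9) * real k ^ 4 * (real r)\<^sup>2 / A) ^ k * real n ^ r"
    using A cW by (intro mult_left_mono) auto
  also have "\<dots> < 1" using large by (simp only: A_def)
  finally obtain xs where xs: "set xs \<subseteq> W" "length xs = 2 * k"
      and walk: "\<And>i. i < 2 * k \<Longrightarrow> parallel col (xs ! i) (xs ! (Suc i mod (2 * k)))"
      and disj: "\<And>i j. j < 2 * k \<Longrightarrow> i < j \<Longrightarrow> set (xs ! i) \<inter> set (xs ! j) = {}"
    using exists_unrelated_closed_walk[OF k] by blast
  have tup: "xs ! j \<in> tuples n r" if "j < 2 * k" for j
  proof -
    have "xs ! j \<in> set xs" using that xs(2) by simp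
    then show ?thesis using xs(1) W(1) by blast
  qed
  show ?thesis
  \<comment> \<open>The \<open>i\<close>-th cycle consists of the \<open>i\<close>-th entries of the
    tuples along the walk.\<close>
  proof (rule has_r_copies_cycleI[where h = "\<lambda>i j. xs ! j ! i"])
    show "2 \<le> 2 * k" using k by simp
    show "xs ! j ! i < n" if "i < r" "j < 2 * k" for i j
    proof -
      have "xs ! j ! i \<in> set (xs ! j)" "set (xs ! j) \<subseteq> {..<n}"
        using tup[OF that(2)] that(1) by (auto simp: tuples_def)
      then show ?thesis by auto
    qed
    show "i = i' \<and> j = j'"
      if "i < r" "i' < r" "j < 2 * k" "j' < 2 * k" and eq: "xs ! j ! i = xs ! j' ! i'" for i i' j j'
    proof -
      have *: "xs ! j ! i \<in> set (xs ! j)" "xs ! j' ! i' \<in> set (xs ! j')"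
        using tup[of j] tup[of j'] that(1-4) by (simp_all add: tuples_def)
      have "j = j'"
      proof (rule ccontr)
        assume "j \<noteq> j'"
        then consider "j < j'" | "j' < j" by linarith
        then show False
          using disj[of j' j] disj[of j j'] that * by cases auto
      qed
      then show ?thesis
        using tup[of j] that nth_eq_iff_index_eq[of "xs ! j" i i'] by (auto simp: tuples_def)
    qed
    show "col {xs ! j ! i, xs ! (Suc j mod (2 * k)) ! i} = col {xs ! j ! i', xs ! (Suc j mod (2 * k)) ! i'}"
      if "i < r" "i' < r" "j < 2 * k" for i i' j
      using walk[OF that(3)] tup[OF that(3)] that by (intro parallelD) (auto simp: tuples_def)
  qed
qed

text \<open>A rainbow colouring; it guarantees that the minimum in the definition of \<open>f_r\<close> is attained.\<close>

lemma exists_colouring_without_copies: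
  assumes "2 \<le> r" "2 \<le> m"
  shows "\<exists>col. proper_colouring n col \<and> \<not> has_r_copies r n (cycle_graph m) col"
proof -
  obtain col :: "nat set \<Rightarrow> nat" where inj: "inj_on col (Kn_edges n)"
    using finite_imp_inj_to_nat_seg[OF finite_Kn_edges] by metis
  have "proper_colouring n col"
    unfolding proper_colouring_def
  proof (intro allI impI notI)
    fix a b d assume *: "a < n \<and> b < n \<and> d < n \<and> a \<noteq> b \<and> a \<noteq> d \<and> b \<noteq> d"
      and "col {a, b} = col {a, d}"
    moreover have "{a, b} \<in> Kn_edges n" "{a, d} \<in> Kn_edges n"
      using * by (auto simp: Kn_edges_def)
    ultimately have "{a, b} = {a, d}" using inj by (meson inj_onD)
    with * show False by (auto simp: doubleton_eq_iff)
  qed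
  moreover have "\<not> has_r_copies r n (cycle_graph m) col"
  proof
    assume "has_r_copies r n (cycle_graph m) col"
    then obtain S :: "nat \<Rightarrow> nat graph" where copy: "is_copy n (cycle_graph m) (S 0)" "is_copy n (cycle_graph m) (S 1)"
        and disj: "fst (S 0) \<inter> fst (S 1) = {}" and iso: "colour_iso col (S 0) (S 1)"
    proof -
      have "0 < r" "1 < r" using assms(1) by auto
      then show ?thesis
        using that \<open>has_r_copies r n (cycle_graph m) col\<close> unfolding has_r_copies_def
        by (metis zero_neq_one)
    qed
    obtain g where g: "graph_iso (cycle_graph m) (S 0) g"
      using copy(1) by (auto simp: is_copy_def)
    have "{0, 1} \<in> snd (cycle_graph m)"
      using assms(2) by (auto simp: cycle_graph_def intro!: exI[of _ 0])
    moreover have "0 \<in> fst (cycle_graph m)" "1 \<in> fst (cycle_graph m)"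
      using assms(2) by (auto simp: cycle_graph_def)
    ultimately obtain a b where ab: "a \<in> fst (S 0)" "b \<in> fst (S 0)" "{a, b} \<in> snd (S 0)"
      using g unfolding graph_iso_def by (meson bij_betwE)
    obtain h where h: "graph_iso (S 0) (S 1) h" "col {h a, h b} = col {a, b}"
      using iso ab by (auto simp: colour_iso_def)
    have "{h a, h b} \<in> snd (S 1)" and ha: "h a \<in> fst (S 1)"
      using h(1) ab by (auto simp: graph_iso_def dest: bij_betwE)
    moreover have sub: "snd (S i) \<subseteq> Kn_edges n" if "is_copy n (cycle_graph m) (S i)" for i
      using that unfolding is_copy_def subgraph_Kn_def Kn_edges_def by blast
    ultimately have "{h a, h b} \<in> Kn_edges n" "{a, b} \<in> Kn_edges n"
      using ab copy by blast+
    \<comment> \<open>An injective colouring forces corresponding edges of the two copies to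
      coincide, although the copies are disjoint.\<close>
    then have "{h a, h b} = {a, b}"
      using inj h(2) by (meson inj_onD)
    then show False using ab ha disj by (auto simp: doubleton_eq_iff)
  qed
  ultimately show ?thesis by blast
qed

section \<open>Choice of parameters and the asymptotic bound\<close>

theorem theorem1p11:
  fixes k r :: nat
  assumes "k \<ge> 2" and "r \<ge> 2"
  shows "\<exists>C>0. \<exists>N. \<forall>n\<ge>N.
           real (f_r r n (cycle_graph (2 * k)))
             \<ge> C * real n powr (real r / (real r - 1) * ((real k - 1) / real k))"
proof -
  define e where "e = real r / (real r - 1) * ((real k - 1) / real k)"
  \<comment> \<open>Twice the constant in the hypothesis \<open>large\<close>, so that the base of
    the k-th power becomes at most \<open>1 / (2 * n powr (r / k))\<close>.\<close>
  define D where "D = 2 ^ (r + 10) * real k ^ 4 * (real r)\<^sup>2"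
  have k1: "1 \<le> real k" and r1: "1 \<le> real r - 1" using assms by auto
  have "(2 :: real) \<le> 2 ^ (r + 10)"
    using power_increasing[of 1 "r + 10" "2 :: real"] by simp
  then have "2 * real r * 1 * 1 \<le> 2 ^ (r + 10) * real r * real r * real k ^ 4"
    using k1 r1 by (intro mult_mono one_le_power) auto
  then have D: "2 * real r \<le> D"
    by (simp add: D_def power2_eq_square mult_ac)
  have D1: "1 \<le> D" using D r1 by linarith
  \<comment> \<open>With \<open>\<theta>\<close> of order n^(2 - e), the degree has order n^(r/k),
    whose k-th power balances the n^r vertices. This identity determines \<open>e\<close>.\<close>
  have e: "(2 - e) * (real r - 1) + 2 - real r = real r / real k"
    using k1 r1 by (simp add: e_def field_simps)
  \<comment> \<open>The bound \<open>e \<le> 2\<close> keeps n^(2 - e) at least 1, so that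
    \<open>\<theta>\<close> is at least \<open>D\<close> and hence at least 2r.\<close>
  have "real r / (real r - 1) \<le> 2" "(real k - 1) / real k \<le> 1"
    using k1 r1 by (auto simp: field_simps)
  then have "e \<le> 2 * 1"
    unfolding e_def using k1 r1 by (intro mult_mono) auto
  then have e2: "e \<le> 2" by simp
  have "1 / (8 * D) * real n powr e \<le> real (f_r r n (cycle_graph (2 * k)))" if n: "2 \<le> n" for n
  proof (rule ccontr)
    assume less: "\<not> ?thesis"
    obtain col where proper: "proper_colouring n col"
        and num: "num_colours n col = f_r r n (cycle_graph (2 * k))"
        and free: "\<not> has_r_copies r n (cycle_graph (2 * k)) col"
    proof -
      have "\<exists>c col. proper_colouring n col \<and> num_colours n col = c \<and>
          \<not> has_r_copies r n (cycle_graph (2 * k)) col"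
        using exists_colouring_without_copies[of r "2 * k" n] assms by auto
      then have "\<exists>col. proper_colouring n col \<and> num_colours n col = f_r r n (cycle_graph (2 * k)) \<and>
          \<not> has_r_copies r n (cycle_graph (2 * k)) col"
        unfolding f_r_def by (rule LeastI_ex)
      then show ?thesis using that by blast
    qed
    define c where "c = real (num_colours n col)"
    have "{0, 1} \<in> Kn_edges n"
      unfolding Kn_edges_def using n by (intro CollectI exI[of _ 0] exI[of _ 1]) auto
    then have "0 < num_colours n col"
      by (auto simp: num_colours_def card_gt_0_iff finite_Kn_edges)
    then have c: "0 < c" by (simp add: c_def)
    have n0: "0 < real n" using n by simp
    have c_less: "c < 1 / (8 * D) * real n powr e"
      using less num by (simp add: c_def)
    \<comment> \<open>The largest value that the condition
      \<open>8 * c * \<theta> \<le> n\<^sup>2\<close> permits.\<close>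
    define \<theta> where "\<theta> = (real n)\<^sup>2 / (8 * c)"
    have "D * real n powr (2 - e) = (real n)\<^sup>2 / (8 * (1 / (8 * D) * real n powr e))"
      using n0 D1 by (simp add: powr_diff)
    also have "\<dots> \<le> \<theta>"
      unfolding \<theta>_def using c c_less n0 D1 by (intro divide_left_mono mult_pos_pos) auto
    finally have \<theta>: "D * real n powr (2 - e) \<le> \<theta>" .
    have "D * 1 \<le> D * real n powr (2 - e)"
      using D1 e2 n by (intro mult_left_mono ge_one_powr_ge_zero) auto
    with \<theta> D have \<theta>r: "2 * real r \<le> \<theta>" by linarith
    have "D * real n powr (real r / real k)
        = D * (real n powr (2 - e)) ^ (r - 1) * (real n)\<^sup>2 / real n ^ r"
    proof -
      have "real n powr (real r / real k)
          = real n powr ((2 - e) * (real r - 1)) * real n powr 2 / real n powr real r"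
        unfolding e[symmetric] by (simp only: powr_diff powr_add)
      moreover have "real n powr ((2 - e) * (real r - 1)) = (real n powr (2 - e)) ^ (r - 1)"
        using n0 assms(2) by (simp add: powr_power mult.commute)
      moreover have "real n powr 2 = (real n)\<^sup>2" "real n powr real r = real n ^ r"
        using n0 by (simp_all add: powr_realpow)
      ultimately show ?thesis by (simp only: times_divide_eq_right mult.assoc)
    qed
    also have "\<dots> \<le> D ^ (r - 1) * (real n powr (2 - e)) ^ (r - 1) * (real n)\<^sup>2 / real n ^ r"
      using D1 assms(2) self_le_power[of D "r - 1"]
      by (intro divide_right_mono mult_right_mono) auto
    also have "\<dots> = (D * real n powr (2 - e)) ^ (r - 1) * (real n)\<^sup>2 / real n ^ r"
      by (simp add: power_mult_distrib)
    also have "\<dots> \<le> \<theta> ^ (r - 1) * (real n)\<^sup>2 / real n ^ r"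
      using \<theta> D1 by (intro divide_right_mono mult_right_mono power_mono) auto
    finally have A: "D * real n powr (real r / real k) \<le> \<theta> ^ (r - 1) * (real n)\<^sup>2 / real n ^ r" .
    have "2 ^ (r + 9) * real k ^ 4 * (real r)\<^sup>2 / (\<theta> ^ (r - 1) * (real n)\<^sup>2 / real n ^ r)
        \<le> (D / 2) / (D * real n powr (real r / real k))"
    proof (rule frac_le)
      show "2 ^ (r + 9) * real k ^ 4 * (real r)\<^sup>2 \<le> D / 2"
        by (simp add: D_def power_add)
    qed (use A D1 n0 in auto)
    also have "\<dots> = 1 / (2 * real n powr (real r / real k))"
      using D1 by simp
    finally have "(2 ^ (r + 9) * real k ^ 4 * (real r)\<^sup>2 / (\<theta> ^ (r - 1) * (real n)\<^sup>2 / real n ^ r)) ^ k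
        * real n ^ r \<le> (1 / (2 * real n powr (real r / real k))) ^ k * real n ^ r"
      using \<theta>r by (intro mult_right_mono power_mono) auto
    \<comment> \<open>The powers of n cancel exactly; the spare factor 2 in \<open>D\<close> leaves
      a quantity below 1.\<close>
    also have "\<dots> = 1 / 2 ^ k"
    proof -
      have "(real n powr (real r / real k)) ^ k = real n ^ r"
        using k1 n0 by (simp add: powr_power powr_realpow)
      then show ?thesis
        using n0 by (simp add: power_divide power_mult_distrib)
    qed
    also have "(1 :: real) / 2 ^ k < 1"
      using assms(1) by simp
    finally have "has_r_copies r n (cycle_graph (2 * k)) col"
      using proper n assms \<theta>r c by (intro has_r_copies_of_few_colours[of n col r k \<theta>])
        (auto simp: \<theta>_def c_def)
    with free show False ..
  qed
  moreover have "0 < 1 / (8 * D)" using D1 by simp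
  ultimately show ?thesis unfolding e_def by blast
qed

end
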